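(* Let $N\ge 1$ be an integer and let $(a_j)_{j=1}^N$ be a sequence of real numbers that are either all non positive or all non negative. Let $$f(x)=\sum_{j=1}^N a_j\,\mathrm{rect}(x-j),\qquad x\in\mathbb{R},$$ and for $\gamma=(t,\xi,u)\in\Gamma=\mathbb{R}_{>0}\times\mathbb{R}^2$ let $$G_\gamma(x)=\frac{1}{\sqrt t}\,\mathrm{rect}\!\left(\frac{x-u}{t}\right)e^{2\pi i\xi x}.$$ Then the function $\gamma\mapsto|\langle f,G_\gamma\rangle|$ on $\Gamma$ attains its maximum at a point $\gamma=(t,\xi,u)$ with $\xi=0$ and with $u$ and $t\ge 1$ integers. Additionally, the maximum value is $$\max_{0\le k\le N-1}\ \max_{1\le n\le N-k}\ \max\left\{\frac{\sum_{j=n}^{n+k}|a_j|}{\sqrt{k+1}},\ \frac{\sum_{j=n}^{n+k-1}|a_j|}{\sqrt{k}},\ \frac{\sum_{j=n-1}^{n+k-1}|a_j|}{\sqrt{k+1}}\right\},$$ where $n$ and $k$ are integers.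
   Context: $\mathrm{rect}:\mathbb{R}\to\mathbb{R}$ is the function equal to $1$ on $[-1/2,1/2]$ and $0$ elsewhere. $\langle\cdot,\cdot\rangle$ is the usual $L^2(\mathbb{R})$ inner product of functions (only its modulus matters here, so complex conjugating $G_\gamma$ or not makes no difference: $|\langle f,G_\gamma\rangle|=\left|\int_{\mathbb{R}} f(x)G_\gamma(x)\,dx\right|$ since $f$ is real-valued and $\xi$ ranges over $\mathbb{R}$). $\mathbb{R}_{>0}$ is the set of positive real numbers. Conventions: $a_j=0$ for $j\notin\{1,\dots,N\}$, and for $k=0$ the middle term in the braces (an empty sum divided by $\sqrt 0$) is omitted.
   Formalization: "u integer" is false as printed (N=2, a=(1,1): the maximum √2 is attained only at t=2, u=3/2); the formal theorem asserts instead that u is an integer when t is odd and an integer plus 1/2 when t is even. *)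

theory Defs
  imports "HOL-Analysis.Analysis"
begin

definition rect :: "real \<Rightarrow> real" where
  "rect x = (if x \<in> {-1/2..1/2} then 1 else 0)"

definition step_fun :: "nat \<Rightarrow> (nat \<Rightarrow> real) \<Rightarrow> real \<Rightarrow> real" where
  "step_fun N a x = (\<Sum>j=1..N. a j * rect (x - real j))"

text \<open>A parameter is a triple \<open>(t, \<xi>, u)\<close> of scale, frequency and centre.\<close>

definition Gamma_set :: "(real \<times> real \<times> real) set" where
  "Gamma_set = {0<..} \<times> UNIV \<times> UNIV"

definition G_atom :: "real \<times> real \<times> real \<Rightarrow> real \<Rightarrow> complex" where
  "G_atom \<gamma> x = (case \<gamma> of (t, \<xi>, u) \<Rightarrow>
     complex_of_real (1 / sqrt t * rect ((x - u) / t)) *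
     exp (2 * complex_of_real pi * \<i> * complex_of_real \<xi> * complex_of_real x))"

definition L2_inner :: "(real \<Rightarrow> complex) \<Rightarrow> (real \<Rightarrow> complex) \<Rightarrow> complex" where
  "L2_inner f g = (\<integral>x. f x * cnj (g x) \<partial>lborel)"

definition atom_coeff :: "nat \<Rightarrow> (nat \<Rightarrow> real) \<Rightarrow> real \<times> real \<times> real \<Rightarrow> real" where
  "atom_coeff N a \<gamma> = cmod (L2_inner (\<lambda>x. complex_of_real (step_fun N a x)) (G_atom \<gamma>))"

text \<open>
  The innermost maximum; for \<open>k = 0\<close> the quotient with denominator \<open>sqrt k\<close> is left out.
  It is only meant for \<open>n \<ge> 1\<close>, where the subtractions on \<^typ>\<open>nat\<close> do not truncate.
  The last sum involves \<open>a 0\<close> if \<open>n = 1\<close>, so \<open>a\<close> has to vanish there.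
\<close>

definition window_max :: "(nat \<Rightarrow> real) \<Rightarrow> nat \<Rightarrow> nat \<Rightarrow> real" where
  "window_max a k n = Max
     ({(\<Sum>j=n..n+k. \<bar>a j\<bar>) / sqrt (real (k + 1))} \<union>
      (if k = 0 then {} else {(\<Sum>j=n..n+k-1. \<bar>a j\<bar>) / sqrt (real k)}) \<union>
      {(\<Sum>j=n-1..n+k-1. \<bar>a j\<bar>) / sqrt (real (k + 1))})"

end

theory Submission
  imports Defs
begin

text \<open>
  The modulus of the coefficient is at most the integral of \<open>\<bar>f\<bar>\<close> over the window
  \<open>[u - t/2, u + t/2]\<close> divided by \<open>sqrt t\<close>, with equality for \<open>\<xi> = 0\<close> because \<open>f\<close> has constant
  sign. A primitive of \<open>\<bar>f\<bar>\<close> is affine on every cell \<open>[k - 1/2, k + 1/2]\<close>, whereas \<open>M * sqrt\<close> is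
  concave for \<open>M \<ge> 0\<close>. Hence the bound \<open>\<integral>\<bar>f\<bar> \<le> M * sqrt t\<close> need only be checked for windows whose
  endpoints are half-integers.
\<close>

text \<open>The integral of \<open>rect\<close> over the half-line ending at
  \<open>y - 1/2\<close>.\<close>

definition ramp :: "real \<Rightarrow> real" where
  "ramp y = max 0 (min 1 y)"

text \<open>
  The argument is shifted by \<open>1/2\<close>: \<open>primitive N a (x + 1/2)\<close> is the integral of \<open>\<bar>f\<bar>\<close> up to \<open>x\<close>,
  so that the cells have integer endpoints.
\<close>

definition primitive :: "nat \<Rightarrow> (nat \<Rightarrow> real) \<Rightarrow> real \<Rightarrow> real" where
  "primitive N a x = (\<Sum>k=1..N. \<bar>a k\<bar> * ramp (x - real k))"

text \<open>Not a mean: the divisor is the square root of the length, as in the normalisation of the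
  atom. With a half-open range, \<open>m\<close> and \<open>n\<close> are the window's endpoints in
  the shifted coordinate.\<close>

definition window_avg :: "(nat \<Rightarrow> real) \<Rightarrow> nat \<Rightarrow> nat \<Rightarrow> real" where
  "window_avg a m n = (\<Sum>j=m..<n. \<bar>a j\<bar>) / sqrt (real n - real m)"

definition windows :: "nat \<Rightarrow> (nat \<times> nat) set" where
  "windows N = {(m, n). 1 \<le> m \<and> m < n \<and> n \<le> N + 1}"

section \<open>Square-root bounds for piecewise affine functions\<close>

lemma sqrt_convex_combination_le:
  fixes x y s :: real
  assumes "0 \<le> x" "0 \<le> y" "0 \<le> s" "s \<le> 1"
  shows "(1 - s) * sqrt x + s * sqrt y \<le> sqrt ((1 - s) * x + s * y)"
proof (rule real_le_rsqrt)
  have "0 \<le> s * (1 - s) * (sqrt x - sqrt y)\<^sup>2"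
    using assms by simp
  moreover have "s * (1 - s) * (sqrt x - sqrt y)\<^sup>2
      = (1 - s) * (sqrt x)\<^sup>2 + s * (sqrt y)\<^sup>2 - ((1 - s) * sqrt x + s * sqrt y)\<^sup>2"
    by algebra
  ultimately show "((1 - s) * sqrt x + s * sqrt y)\<^sup>2 \<le> (1 - s) * x + s * y"
    using assms by simp
qed

text \<open>If the endpoints lie in different cells, each is replaced in turn by the two integers
  around it: the increment of \<open>P\<close> and the length are convex combinations with the same
  weights, so concavity of \<open>sqrt\<close> transfers the bound. Within a single cell the slope
  of \<open>P\<close> decides.\<close>

lemma piecewise_affine_le_sqrt:
  fixes P :: "real \<Rightarrow> real"
  assumes affine: "\<And>x. P x = (1 - frac x) * P (of_int \<lfloor>x\<rfloor>) + frac x * P (of_int (\<lfloor>x\<rfloor> + 1))"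
    and bound: "\<And>i j :: int. i \<le> j \<Longrightarrow> P (of_int j) - P (of_int i) \<le> M * sqrt (of_int (j - i))"
    and "0 \<le> M" "p \<le> q"
  shows "P q - P p \<le> M * sqrt (q - p)"
proof -
  have frac: "0 \<le> frac x" "frac x \<le> 1" for x :: real
    using frac_lt_1[of x] by (simp_all add: frac_ge_0 less_imp_le)
  have combine: "(1 - s) * A + s * B \<le> M * sqrt ((1 - s) * x + s * y)"
    if "A \<le> M * sqrt x" "B \<le> M * sqrt y" "0 \<le> x" "0 \<le> y" "0 \<le> s" "s \<le> 1" for A B x y s
  proof -
    have "(1 - s) * A + s * B \<le> (1 - s) * (M * sqrt x) + s * (M * sqrt y)"
      using that by (intro add_mono mult_left_mono) auto
    also have "\<dots> = M * ((1 - s) * sqrt x + s * sqrt y)"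
      by (simp add: algebra_simps)
    also have "\<dots> \<le> M * sqrt ((1 - s) * x + s * y)"
      using that \<open>0 \<le> M\<close> by (intro mult_left_mono sqrt_convex_combination_le) auto
    finally show ?thesis .
  qed
  have right: "P q - P (of_int i) \<le> M * sqrt (q - of_int i)" if "of_int i \<le> q" for i
  proof -
    have i: "i \<le> \<lfloor>q\<rfloor>"
      using that by (simp add: le_floor_iff)
    have "(1 - frac q) * (P (of_int \<lfloor>q\<rfloor>) - P (of_int i))
        + frac q * (P (of_int (\<lfloor>q\<rfloor> + 1)) - P (of_int i))
      \<le> M * sqrt ((1 - frac q) * of_int (\<lfloor>q\<rfloor> - i) + frac q * of_int (\<lfloor>q\<rfloor> + 1 - i))"
      using i frac by (intro combine bound) auto
    moreover have "(1 - frac q) * of_int (\<lfloor>q\<rfloor> - i) + frac q * of_int (\<lfloor>q\<rfloor> + 1 - i) = q - of_int i"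
      by (simp add: frac_def algebra_simps)
    ultimately show ?thesis
      by (subst affine) (simp add: algebra_simps)
  qed
  show ?thesis
  \<comment> \<open>\<open>right\<close> may be used at both integers around \<open>p\<close> only
    if the larger one does not pass \<open>q\<close>.\<close>
  proof (cases "of_int (\<lfloor>p\<rfloor> + 1) \<le> q")
    case True
    have "(1 - frac p) * (P q - P (of_int \<lfloor>p\<rfloor>)) + frac p * (P q - P (of_int (\<lfloor>p\<rfloor> + 1)))
      \<le> M * sqrt ((1 - frac p) * (q - of_int \<lfloor>p\<rfloor>) + frac p * (q - of_int (\<lfloor>p\<rfloor> + 1)))"
      using True frac by (intro combine right) auto
    moreover have "(1 - frac p) * (q - of_int \<lfloor>p\<rfloor>) + frac p * (q - of_int (\<lfloor>p\<rfloor> + 1)) = q - p"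
      by (simp add: frac_def algebra_simps)
    ultimately show ?thesis
      using affine[of p] by (simp add: algebra_simps)
  next
    case False
    then have floor: "\<lfloor>q\<rfloor> = \<lfloor>p\<rfloor>"
      using \<open>p \<le> q\<close> by (intro floor_unique) linarith+
    have d: "0 \<le> q - p" "q - p \<le> 1"
      using False \<open>p \<le> q\<close> by linarith+
    \<comment> \<open>Both points lie in one cell, where \<open>P\<close> has slope at most
      \<open>M\<close> by the bound for length 1; then \<open>d \<le> sqrt d\<close> for
      \<open>d\<close> in \<open>[0, 1]\<close> finishes.\<close>
    have "P q - P p = (q - p) * (P (of_int (\<lfloor>p\<rfloor> + 1)) - P (of_int \<lfloor>p\<rfloor>))"
      by (subst affine[of q], subst affine[of p]) (simp add: frac_def floor algebra_simps)
    also have "\<dots> \<le> (q - p) * M"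
      using bound[of "\<lfloor>p\<rfloor>" "\<lfloor>p\<rfloor> + 1"] d by (intro mult_left_mono) auto
    also have "\<dots> \<le> M * sqrt (q - p)"
    proof -
      have "q - p = sqrt (q - p) * sqrt (q - p)"
        using d by simp
      also have "\<dots> \<le> 1 * sqrt (q - p)"
        using d by (intro mult_right_mono) auto
      finally show ?thesis
        using mult_left_mono[of "q - p" "sqrt (q - p)" M] \<open>0 \<le> M\<close> by (simp add: mult.commute)
    qed
    finally show ?thesis .
  qed
qed

section \<open>The primitive of the modulus of the step function\<close>

text \<open>The kinks of \<open>ramp\<close> are at 0 and 1, so those of its integer translates are
  at integers. The cell of \<open>x\<close> lies before the rise, is the rise, or lies after
  it.\<close>

lemma ramp_affine:
  "ramp (x - real k) = (1 - frac x) * ramp (of_int \<lfloor>x\<rfloor> - real k) + frac x * ramp (of_int (\<lfloor>x\<rfloor> + 1) - real k)"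
proof -
  have x: "x = of_int \<lfloor>x\<rfloor> + frac x" and f: "0 \<le> frac x" "frac x < 1"
    by (simp_all add: frac_def) linarith
  consider "\<lfloor>x\<rfloor> < int k" | "\<lfloor>x\<rfloor> = int k" | "\<lfloor>x\<rfloor> > int k"
    by linarith
  then show ?thesis
  proof cases
    case 1
    then have "real_of_int \<lfloor>x\<rfloor> + 1 \<le> real k"
      by linarith
    with x f show ?thesis
      by (auto simp: ramp_def max_def min_def)
  next
    case 2
    then have "real_of_int \<lfloor>x\<rfloor> = real k"
      by simp
    moreover from this have "ramp (x - real k) = frac x"
      unfolding ramp_def using x f by linarith
    ultimately show ?thesis
      by (simp add: ramp_def)
  next
    case 3
    then have "real_of_int \<lfloor>x\<rfloor> \<ge> real k + 1"
      by linarith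
    moreover from this have "ramp (x - real k) = 1"
      unfolding ramp_def using x f by linarith
    ultimately show ?thesis
      by (simp add: ramp_def)
  qed
qed

lemma primitive_affine:
  "primitive N a x = (1 - frac x) * primitive N a (of_int \<lfloor>x\<rfloor>) + frac x * primitive N a (of_int (\<lfloor>x\<rfloor> + 1))"
proof -
  have "primitive N a x = (\<Sum>k=1..N. (1 - frac x) * (\<bar>a k\<bar> * ramp (of_int \<lfloor>x\<rfloor> - real k))
      + frac x * (\<bar>a k\<bar> * ramp (of_int (\<lfloor>x\<rfloor> + 1) - real k)))"
    unfolding primitive_def
    by (intro sum.cong refl) (subst ramp_affine, simp only: algebra_simps)
  then show ?thesis
    by (simp only: primitive_def sum.distrib sum_distrib_left)
qed

text \<open>At integers every ramp is 0 or 1, so the increment counts whole cells.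
  \<open>max\<close> and \<open>min\<close> clip the window to the support \<open>1..N\<close>; the
  truncation by \<open>nat\<close> is harmless since a negative endpoint lies left of 1.\<close>

lemma primitive_diff_int:
  assumes "i \<le> j"
  shows "primitive N a (of_int j) - primitive N a (of_int i) =
    (\<Sum>k\<in>{max 1 (nat i)..<min (N + 1) (nat j)}. \<bar>a k\<bar>)"
proof -
  have "primitive N a (of_int j) - primitive N a (of_int i) =
      (\<Sum>k=1..N. if i \<le> int k \<and> int k < j then \<bar>a k\<bar> else 0)"
    unfolding primitive_def sum_subtractf[symmetric]
  proof (intro sum.cong refl)
    fix k
    have ramp: "ramp (of_int l - real k) = (if int k < l then 1 else 0)" for l :: int
      by (cases "int k < l") (auto simp: ramp_def max_def min_def; linarith)+
    show "\<bar>a k\<bar> * ramp (of_int j - real k) - \<bar>a k\<bar> * ramp (of_int i - real k) =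
        (if i \<le> int k \<and> int k < j then \<bar>a k\<bar> else 0)"
      using assms by (auto simp: ramp)
  qed
  also have "\<dots> = (\<Sum>k\<in>{k\<in>{1..N}. i \<le> int k \<and> int k < j}. \<bar>a k\<bar>)"
    by (rule sum.inter_filter[symmetric]) simp
  also have "{k\<in>{1..N}. i \<le> int k \<and> int k < j} = {max 1 (nat i)..<min (N + 1) (nat j)}"
    by auto
  finally show ?thesis .
qed

text \<open>Clipping an integer window to the support keeps its sum and can only shorten it, so as
  \<open>M \<ge> 0\<close> the bound on \<open>windows N\<close> reaches all integer windows, and by
  concavity all real ones.\<close>

lemma primitive_diff_le:
  assumes avg: "\<And>m n. (m, n) \<in> windows N \<Longrightarrow> window_avg a m n \<le> M"
    and "0 \<le> M" "p \<le> q"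
  shows "primitive N a q - primitive N a p \<le> M * sqrt (q - p)"
proof (rule piecewise_affine_le_sqrt[OF primitive_affine _ \<open>0 \<le> M\<close> \<open>p \<le> q\<close>])
  fix i j :: int
  assume "i \<le> j"
  define m n where "m = max 1 (nat i)" and "n = min (N + 1) (nat j)"
  have "(\<Sum>k=m..<n. \<bar>a k\<bar>) \<le> M * sqrt (of_int (j - i))"
  proof (cases "m < n")
    case True
    then have "(m, n) \<in> windows N"
      by (auto simp: windows_def m_def n_def)
    then have "(\<Sum>k=m..<n. \<bar>a k\<bar>) \<le> M * sqrt (real n - real m)"
      using avg[of m n] True by (simp add: window_avg_def field_simps)
    also have "\<dots> \<le> M * sqrt (of_int (j - i))"
    proof (intro mult_left_mono[OF _ \<open>0 \<le> M\<close>] real_sqrt_le_mono)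
      have "int n - int m \<le> j - i"
        using True by (auto simp: m_def n_def)
      then show "real n - real m \<le> of_int (j - i)"
        by linarith
    qed
    finally show ?thesis .
  next
    case False
    then show ?thesis
      using \<open>0 \<le> M\<close> \<open>i \<le> j\<close> by simp
  qed
  then show "primitive N a (of_int j) - primitive N a (of_int i) \<le> M * sqrt (of_int (j - i))"
    using primitive_diff_int[OF \<open>i \<le> j\<close>] by (simp add: m_def n_def)
qed

section \<open>Coefficients as increments of the primitive\<close>

lemma has_bochner_integral_rect_mult:
  assumes "0 < t"
  shows "has_bochner_integral lborel (\<lambda>x. rect (x - real k) * rect ((x - u) / t))
    (ramp (u + t / 2 + 1 / 2 - real k) - ramp (u - t / 2 + 1 / 2 - real k))"
proof -
  \<comment> \<open>The product is the indicator of the intersection of the cell with the window. If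
    they are disjoint, then \<open>r < l\<close>, and both the measure and the ramp increment are
    0.\<close>
  define l r where "l = max (real k - 1/2) (u - t/2)" and "r = min (real k + 1/2) (u + t/2)"
  have eq: "rect (x - real k) * rect ((x - u) / t) = indicator {l..r} x" for x
  proof -
    have "(x - u) / t \<in> {-1/2..1/2} \<longleftrightarrow> x \<in> {u - t/2..u + t/2}"
      using assms by (auto simp: field_simps)
    moreover have "x - real k \<in> {-1/2..1/2} \<longleftrightarrow> x \<in> {real k - 1/2..real k + 1/2}"
      by auto
    ultimately show ?thesis
      by (auto simp: rect_def l_def r_def indicator_def)
  qed
  have "has_bochner_integral lborel (indicator {l..r}) (measure lborel {l..r})"
    by (rule has_bochner_integral_real_indicator) (auto simp: emeasure_lborel_Icc_eq)
  also have "measure lborel {l..r} =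
      ramp (u + t / 2 + 1 / 2 - real k) - ramp (u - t / 2 + 1 / 2 - real k)"
    using assms by (auto simp: measure_def emeasure_lborel_Icc_eq l_def r_def ramp_def max_def min_def)
  finally show ?thesis
    by (simp add: eq[abs_def])
qed

text \<open>The coefficients \<open>b\<close> are general because both \<open>a\<close> and its
  absolute values are inserted later.\<close>

lemma has_bochner_integral_step_rect:
  assumes "0 < t"
  shows "has_bochner_integral lborel (\<lambda>x. step_fun N b x * (1 / sqrt t * rect ((x - u) / t)))
    ((\<Sum>k=1..N. b k * (ramp (u + t / 2 + 1 / 2 - real k) - ramp (u - t / 2 + 1 / 2 - real k))) / sqrt t)"
proof -
  have "has_bochner_integral lborel
      (\<lambda>x. (\<Sum>k=1..N. b k * (rect (x - real k) * rect ((x - u) / t))) / sqrt t)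
      ((\<Sum>k=1..N. b k * (ramp (u + t / 2 + 1 / 2 - real k) - ramp (u - t / 2 + 1 / 2 - real k))) / sqrt t)"
    using has_bochner_integral_rect_mult[OF assms]
    by (intro has_bochner_integral_divide_zero has_bochner_integral_sum has_bochner_integral_mult_right) auto
  then show ?thesis
    by (simp add: step_fun_def sum_distrib_right sum_distrib_left sum_divide_distrib mult_ac)
qed

text \<open>Triangle inequality under the integral: the exponential has modulus 1, and the step
  function with coefficients \<open>\<bar>a k\<bar>\<close> dominates the modulus of
  \<open>step_fun N a\<close>.\<close>

lemma atom_coeff_le:
  assumes "0 < t"
  shows "atom_coeff N a (t, \<xi>, u) \<le>
    (primitive N a (u + t / 2 + 1 / 2) - primitive N a (u - t / 2 + 1 / 2)) / sqrt t"
proof -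
  define g where "g x = step_fun N (\<lambda>k. \<bar>a k\<bar>) x * (1 / sqrt t * rect ((x - u) / t))" for x
  have rect_nonneg: "0 \<le> rect x" for x
    by (simp add: rect_def)
  have step: "\<bar>step_fun N a x\<bar> \<le> step_fun N (\<lambda>k. \<bar>a k\<bar>) x" for x
    unfolding step_fun_def
    by (rule order_trans[OF sum_abs]) (simp add: abs_mult rect_nonneg)
  have g_int: "has_bochner_integral lborel g
      ((primitive N a (u + t / 2 + 1 / 2) - primitive N a (u - t / 2 + 1 / 2)) / sqrt t)"
    using has_bochner_integral_step_rect[OF assms, of N "\<lambda>k. \<bar>a k\<bar>" u]
    by (simp add: g_def[abs_def] primitive_def sum_subtractf right_diff_distrib)
  have "atom_coeff N a (t, \<xi>, u) \<le>
      (\<integral>x. norm (complex_of_real (step_fun N a x) * cnj (G_atom (t, \<xi>, u) x)) \<partial>lborel)"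
    unfolding atom_coeff_def L2_inner_def by (rule integral_norm_bound)
  also have "\<dots> \<le> (\<integral>x. g x \<partial>lborel)"
  \<comment> \<open>This rule asks for integrability of the majorant \<open>g\<close> alone,
    together with \<open>0 \<le> g x\<close>.\<close>
  proof (rule integral_mono')
    show "integrable lborel g"
      using g_int by (rule integrable.intros)
    fix x
    have "cmod (exp (2 * complex_of_real pi * \<i> * complex_of_real \<xi> * complex_of_real x)) = 1"
      by (simp add: norm_exp_eq_Re)
    then show "norm (complex_of_real (step_fun N a x) * cnj (G_atom (t, \<xi>, u) x)) \<le> g x"
      using step[of x] assms
      by (auto simp: G_atom_def g_def norm_mult norm_divide rect_nonneg intro!: mult_right_mono divide_right_mono)
    show "0 \<le> g x"
      using step[of x] assms by (auto simp: g_def rect_nonneg intro!: mult_nonneg_nonneg divide_nonneg_nonneg)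
  qed
  finally show ?thesis
    using g_int by (simp add: has_bochner_integral_integral_eq)
qed

text \<open>For frequency 0 the exponential is 1, and with constant sign no cancellation occurs in
  the sum, so the upper bound is attained.\<close>

lemma atom_coeff_zero_freq:
  assumes "0 < t" and sign: "(\<forall>j\<in>{1..N}. a j \<le> 0) \<or> (\<forall>j\<in>{1..N}. a j \<ge> 0)"
  shows "atom_coeff N a (t, 0, u) =
    (primitive N a (u + t / 2 + 1 / 2) - primitive N a (u - t / 2 + 1 / 2)) / sqrt t"
proof -
  \<comment> \<open>\<open>w k\<close> is the length of the overlap of cell \<open>k\<close> with
    the window.\<close>
  define w where "w k = ramp (u + t / 2 + 1 / 2 - real k) - ramp (u - t / 2 + 1 / 2 - real k)" for k
  have w: "0 \<le> w k" for k
    using \<open>0 < t\<close> by (auto simp: w_def ramp_def)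
  have "L2_inner (\<lambda>x. complex_of_real (step_fun N a x)) (G_atom (t, 0, u)) =
      (\<integral>x. complex_of_real (step_fun N a x * (1 / sqrt t * rect ((x - u) / t))) \<partial>lborel)"
    by (simp add: L2_inner_def G_atom_def)
  also have "\<dots> = complex_of_real ((\<Sum>k=1..N. a k * w k) / sqrt t)"
    using has_bochner_integral_step_rect[OF \<open>0 < t\<close>, of N a u]
    by (simp only: integral_complex_of_real has_bochner_integral_integral_eq w_def)
  finally have "atom_coeff N a (t, 0, u) = \<bar>\<Sum>k=1..N. a k * w k\<bar> / sqrt t"
    using \<open>0 < t\<close> by (simp only: atom_coeff_def norm_of_real) (simp add: abs_divide)
  also have "\<bar>\<Sum>k=1..N. a k * w k\<bar> = (\<Sum>k=1..N. \<bar>a k\<bar> * w k)"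
    using sign
  proof
    assume neg: "\<forall>j\<in>{1..N}. a j \<le> 0"
    then have "(\<Sum>k=1..N. \<bar>a k\<bar> * w k) = - (\<Sum>k=1..N. a k * w k)"
      by (simp add: sum_negf[symmetric] del: sum_negf)
    moreover have "0 \<le> (\<Sum>k=1..N. \<bar>a k\<bar> * w k)"
      by (intro sum_nonneg mult_nonneg_nonneg w) auto
    ultimately show ?thesis
      by simp
  next
    assume pos: "\<forall>j\<in>{1..N}. a j \<ge> 0"
    then have "(\<Sum>k=1..N. \<bar>a k\<bar> * w k) = (\<Sum>k=1..N. a k * w k)"
      by simp
    moreover have "0 \<le> (\<Sum>k=1..N. \<bar>a k\<bar> * w k)"
      by (intro sum_nonneg mult_nonneg_nonneg w) auto
    ultimately show ?thesis
      by simp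
  qed
  also have "\<dots> = primitive N a (u + t / 2 + 1 / 2) - primitive N a (u - t / 2 + 1 / 2)"
    by (simp add: primitive_def w_def sum_subtractf right_diff_distrib)
  finally show ?thesis .
qed

section \<open>Window averages and the maximum over \<open>k\<close> and \<open>n\<close>\<close>

lemma window_max_ge: "window_avg a n (n + k + 1) \<le> window_max a k n"
  unfolding window_max_def window_avg_def
  by (rule Max_ge) (auto simp: atLeastLessThanSuc_atLeastAtMost)

text \<open>Each of the three quotients is an average over a window in \<open>windows N\<close>,
  except the third one at the left edge \<open>n = 1\<close>.\<close>

lemma window_max_le:
  assumes avg: "\<And>m n. (m, n) \<in> windows N \<Longrightarrow> window_avg a m n \<le> M"
    and "0 \<le> M" "a 0 = 0" "1 \<le> n" "n + k \<le> N"
  shows "window_max a k n \<le> M"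
  unfolding window_max_def
proof (rule Max.boundedI)
  have first: "(\<Sum>j=n..n+k. \<bar>a j\<bar>) / sqrt (real (k + 1)) \<le> M"
    using avg[of n "n + k + 1"] assms(4,5)
    by (simp add: windows_def window_avg_def atLeastLessThanSuc_atLeastAtMost)
  have second: "(\<Sum>j=n..n+k-1. \<bar>a j\<bar>) / sqrt (real k) \<le> M" if "k \<noteq> 0"
  proof -
    have "{n..<n+k} = {n..n+k-1}"
      using that by auto
    then show ?thesis
      using avg[of n "n + k"] assms(4,5) that by (simp add: windows_def window_avg_def)
  qed
  have third: "(\<Sum>j=n-1..n+k-1. \<bar>a j\<bar>) / sqrt (real (k + 1)) \<le> M"
  \<comment> \<open>For \<open>n = 1\<close> the range starts at 0, outside
    \<open>windows N\<close>. Since \<open>a 0 = 0\<close>, the quotient is 0 if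
    \<open>k = 0\<close>, and otherwise it is the second quotient with a larger divisor.\<close>
  proof (cases "n = 1")
    case True
    show ?thesis
    proof (cases "k = 0")
      case True
      then show ?thesis
        using \<open>n = 1\<close> assms by simp
    next
      case False
      have "(\<Sum>j=n-1..n+k-1. \<bar>a j\<bar>) = (\<Sum>j=n..n+k-1. \<bar>a j\<bar>)"
        using \<open>a 0 = 0\<close> True by (simp add: sum.atLeast_Suc_atMost)
      then have "(\<Sum>j=n-1..n+k-1. \<bar>a j\<bar>) / sqrt (real (k + 1)) = (\<Sum>j=n..n+k-1. \<bar>a j\<bar>) / sqrt (real (k + 1))"
        by simp
      also have "\<dots> \<le> (\<Sum>j=n..n+k-1. \<bar>a j\<bar>) / sqrt (real k)"
        using False by (intro divide_left_mono) (auto intro: sum_nonneg)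
      also have "\<dots> \<le> M"
        by (rule second[OF False])
      finally show ?thesis
        by simp
    qed
  next
    case False
    then have "{n-1..<n+k} = {n-1..n+k-1}"
      using \<open>1 \<le> n\<close> by auto
    moreover have "real (n + k) - real (n - 1) = real (k + 1)"
      using \<open>1 \<le> n\<close> by linarith
    moreover have "(n - 1, n + k) \<in> windows N"
      using False assms(4,5) by (auto simp: windows_def)
    ultimately show ?thesis
      using avg[of "n - 1" "n + k"] by (simp only: window_avg_def)
  qed
  fix y
  assume "y \<in> {(\<Sum>j=n..n+k. \<bar>a j\<bar>) / sqrt (real (k + 1))} \<union>
      (if k = 0 then {} else {(\<Sum>j=n..n+k-1. \<bar>a j\<bar>) / sqrt (real k)}) \<union>
      {(\<Sum>j=n-1..n+k-1. \<bar>a j\<bar>) / sqrt (real (k + 1))}"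
  then show "y \<le> M"
    using first second third by (auto split: if_splits)
qed auto

theorem theorem1p1:
  fixes N :: nat and a :: "nat \<Rightarrow> real"
  assumes "N \<ge> 1"
    and "(\<forall>j\<in>{1..N}. a j \<le> 0) \<or> (\<forall>j\<in>{1..N}. a j \<ge> 0)"
    and "\<And>j. j \<notin> {1..N} \<Longrightarrow> a j = 0"
  shows "\<exists>(t::nat) (u::real).
           t \<ge> 1 \<and>
           (if odd t then u \<in> \<int> else u - 1/2 \<in> \<int>) \<and>
           (real t, 0, u) \<in> Gamma_set \<and>
           (\<forall>\<gamma>\<in>Gamma_set. atom_coeff N a \<gamma> \<le> atom_coeff N a (real t, 0, u)) \<and>
           atom_coeff N a (real t, 0, u) =
             (MAX k\<in>{0..N-1}. MAX n\<in>{1..N-k}. window_max a k n)"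
proof -
  define V where "V = (\<lambda>(m, n). window_avg a m n) ` windows N"
  have "windows N \<subseteq> {..N+1} \<times> {..N+1}"
    by (auto simp: windows_def)
  then have "finite V"
    unfolding V_def by (intro finite_imageI) (rule finite_subset, auto)
  have "(1, 2) \<in> windows N"
    using \<open>N \<ge> 1\<close> by (simp add: windows_def)
  then have "V \<noteq> {}"
    by (auto simp: V_def)
  define M where "M = Max V"
  have avg: "window_avg a m n \<le> M" if "(m, n) \<in> windows N" for m n
    unfolding M_def using \<open>finite V\<close> that by (intro Max_ge) (auto simp: V_def)
  have "0 \<le> M"
    using avg[OF \<open>(1, 2) \<in> windows N\<close>]
    by (rule order_trans[rotated]) (auto simp: window_avg_def intro!: divide_nonneg_nonneg sum_nonneg)
  have "M \<in> V"
    unfolding M_def using \<open>finite V\<close> \<open>V \<noteq> {}\<close> by (rule Max_in)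
  then obtain m n where mn: "(m, n) \<in> windows N" "window_avg a m n = M"
    by (auto simp: V_def)
  then have "1 \<le> m" "m < n" "n \<le> N + 1"
    by (auto simp: windows_def)
  \<comment> \<open>Length and midpoint of the optimal window, which is
    \<open>[m - 1/2, n - 1/2]\<close> in the original coordinate.\<close>
  define t where "t = n - m"
  define u where "u = (real m + real n - 1) / 2"
  have t: "real t = real n - real m" "t \<ge> 1"
    using \<open>m < n\<close> by (auto simp: t_def)
  have ends: "u + real t / 2 + 1 / 2 = of_int (int n)" "u - real t / 2 + 1 / 2 = of_int (int m)"
    by (simp_all add: u_def t field_simps)

  have attained: "atom_coeff N a (real t, 0, u) = M"
  proof -
    have "primitive N a (of_int (int n)) - primitive N a (of_int (int m)) = (\<Sum>k=m..<n. \<bar>a k\<bar>)"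
      using \<open>1 \<le> m\<close> \<open>m < n\<close> \<open>n \<le> N + 1\<close> by (subst primitive_diff_int) (auto simp: max_absorb2 min_absorb2)
    then show ?thesis
      using mn(2) \<open>t \<ge> 1\<close> assms(2)
      by (subst atom_coeff_zero_freq) (simp_all only: ends, simp_all add: window_avg_def t)
  qed

  have upper: "atom_coeff N a \<gamma> \<le> M" if "\<gamma> \<in> Gamma_set" for \<gamma>
  proof -
    obtain t' \<xi> u' where \<gamma>: "\<gamma> = (t', \<xi>, u')" "0 < t'"
      using \<open>\<gamma> \<in> Gamma_set\<close> by (cases \<gamma>) (auto simp: Gamma_set_def)
    have "primitive N a (u' + t' / 2 + 1 / 2) - primitive N a (u' - t' / 2 + 1 / 2)
        \<le> M * sqrt ((u' + t' / 2 + 1 / 2) - (u' - t' / 2 + 1 / 2))"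
      using \<open>0 < t'\<close> by (intro primitive_diff_le avg \<open>0 \<le> M\<close>) auto
    then have "primitive N a (u' + t' / 2 + 1 / 2) - primitive N a (u' - t' / 2 + 1 / 2) \<le> M * sqrt t'"
      by simp
    then have "(primitive N a (u' + t' / 2 + 1 / 2) - primitive N a (u' - t' / 2 + 1 / 2)) / sqrt t' \<le> M"
      using \<open>0 < t'\<close> by (simp add: divide_le_eq)
    then show ?thesis
      using atom_coeff_le[OF \<open>0 < t'\<close>, of N a \<xi> u'] \<gamma> by simp
  qed

  \<comment> \<open>Both endpoints are half-integers, so the midpoint is an integer for odd length
    and a half-integer for even length.\<close>
  have parity: "if odd t then u \<in> \<int> else u - 1/2 \<in> \<int>"
  proof (cases "odd t")
    case True
    then obtain l where "t = 2 * l + 1"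
      by (elim oddE)
    then have "u = real (m + l)"
      using t by (simp add: u_def)
    with True show ?thesis
      by (simp only: if_True Ints_of_nat simp_thms)
  next
    case False
    then obtain l where "t = 2 * l"
      by (auto elim: evenE)
    then have "u - 1/2 = of_int (int m + int l - 1)"
      using t by (simp add: u_def field_simps)
    with False show ?thesis
      by (simp only: if_False Ints_of_int simp_thms)
  qed

  have "(MAX k\<in>{0..N-1}. MAX n\<in>{1..N-k}. window_max a k n) = M"
  proof (rule antisym)
    have "window_max a k n \<le> M" if "k \<in> {0..N-1}" "n \<in> {1..N-k}" for k n
      using that assms(3)[of 0] \<open>N \<ge> 1\<close> by (intro window_max_le[OF avg \<open>0 \<le> M\<close>]) auto
    then show "(MAX k\<in>{0..N-1}. MAX n\<in>{1..N-k}. window_max a k n) \<le> M"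
      using \<open>N \<ge> 1\<close> by (auto intro!: Max.boundedI)
  next
    \<comment> \<open>The optimal window has \<open>k + 1\<close> cells and starts at
      \<open>m\<close>, so it is the first quotient in \<open>window_max a k m\<close>.\<close>
    define k where "k = t - 1"
    have k: "k \<in> {0..N-1}" "m \<in> {1..N-k}" "m + k + 1 = n"
      using \<open>1 \<le> m\<close> \<open>m < n\<close> \<open>n \<le> N + 1\<close> by (auto simp: k_def t_def)
    have "M \<le> window_max a k m"
      using window_max_ge[of a m k] mn(2) k(3) by simp
    also have "\<dots> \<le> (MAX n\<in>{1..N-k}. window_max a k n)"
      using k by (intro Max_ge) auto
    also have "\<dots> \<le> (MAX k\<in>{0..N-1}. MAX n\<in>{1..N-k}. window_max a k n)"
      using k by (intro Max_ge) auto
    finally show "M \<le> (MAX k\<in>{0..N-1}. MAX n\<in>{1..N-k}. window_max a k n)" .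
  qed
  with attained upper parity \<open>t \<ge> 1\<close> show ?thesis
    by (intro exI[of _ t] exI[of _ u]) (auto simp: Gamma_set_def)
qed

end
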